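(* Let $A$ be a $d\times n$ integer matrix of rank $d$ with columns $\mathbf{a}_1,\dots,\mathbf{a}_n$ and $\ker(A)\cap\mathbb{R}^n_{\ge0}=\{\mathbf{0}\}$. Let $\gamma$ be an external chamber of $A$ with external facet $f$, and let $\boldsymbol{\iota}$ be the minimal inner facet normal of $f$. Suppose the external columns of $\gamma$ are $\mathbf{a}_1,\dots,\mathbf{a}_{d-1}$, and let $\mathbf{a}_{d+\ell}$ be a column of $A$ for some $\ell\in\{0,\dots,n-d\}$. Assume $\mathcal{S}(\mathbf{a}_1,\dots,\mathbf{a}_{d-1})$ is saturated in $\mathcal{L}(A)$. Then $p_A^\gamma$ is a polynomial on $\gamma\cap\mathcal{S}(A)$ if and only if there is a positive integer $\beta$ such that for each $j=1,\dots,n$, $$\boldsymbol{\iota}\cdot\mathbf{a}_j=\begin{cases}0 & \text{if }\mathbf{a}_j\in f,\\ \beta & \text{if }\mathbf{a}_j\notin f.\end{cases}$$ Moreover, if $p_A^\gamma$ is a polynomial on $\mathcal{S}(A)$, then for each $\mathbf{b}\in\gamma\cap\mathcal{S}(A)$, $$p_A^\gamma(\mathbf{b})=\binom{\frac{\boldsymbol{\iota}\cdot\mathbf{b}}{\beta}+n-d}{n-d}=\binom{\frac{\det(\mathbf{a}_1,\dots,\mathbf{a}_{d-1},\mathbf{b})}{\det(\mathbf{a}_1,\dots,\mathbf{a}_{d-1},\mathbf{a}_{d+\ell})}+n-d}{n-d}.$$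
   Context: $\operatorname{pos}_{\mathbb{R}}(\cdot)$ is the cone of nonnegative real combinations. A simplicial cone of $A$ is $\operatorname{pos}_{\mathbb{R}}(A_s)$ for a set $s$ of columns with $|s|=\operatorname{rank}(A_s)=d$. The chamber complex of $A$ is the fan formed by the cones $\bigcap\{\text{simplicial cones of }A\text{ containing }\mathbf{b}\}$, $\mathbf{b}\in\operatorname{pos}_{\mathbb{R}}(A)$, with their faces; its $d$-dimensional cones are chambers. $p_A(\mathbf{b})=\#\{\mathbf{x}\in\mathbb{N}^n:A\mathbf{x}=\mathbf{b}\}$ and $p_A^\gamma$ is the quasi-polynomial agreeing with $p_A$ on $\gamma\cap\mathbb{Z}^d$. A column is external if it is not in the cone generated by the other columns. A chamber is external if all but exactly one of its rays are generated by external columns of $A$; the cone generated by its external ray generators is its external facet. A minimal inner facet normal of a facet of a cone is the primitive integer vector normal to the facet and pointing into the cone. $\mathcal{L}(\cdot)$, $\mathcal{S}(\cdot)$ are the lattice and $\mathbb{N}$-semigroup generated; $\mathcal{S}(A_s)$ is saturated in $\mathcal{L}(A)$ if $\mathcal{S}(A_s)=\mathcal{L}(A)\cap\operatorname{pos}_{\mathbb{R}}(A_s)$. *)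

theory Defs
  imports "HOL-Analysis.Analysis"
begin

definition rvec :: "int ^ 'd \<Rightarrow> real ^ 'd" where
  "rvec v = (\<chi> i. real_of_int (v $ i))"

definition nvec :: "nat ^ 'n \<Rightarrow> int ^ 'n" where
  "nvec x = (\<chi> j. int (x $ j))"

definition rcol :: "int ^ 'n ^ 'd \<Rightarrow> 'n \<Rightarrow> real ^ 'd" where
  "rcol A j = rvec (column j A)"

text \<open>Submatrices \<open>A\<^sub>s\<close> are represented by the set \<open>s\<close> of column indices; repeated columns of
  \<open>A\<close> are therefore kept apart.\<close>

definition pos_cone :: "int ^ 'n ^ 'd \<Rightarrow> 'n set \<Rightarrow> (real ^ 'd) set" where
  "pos_cone A s = {\<Sum>j\<in>s. c j *\<^sub>R rcol A j | c. \<forall>j\<in>s. 0 \<le> c j}"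

definition simplicial_cones :: "int ^ 'n ^ 'd \<Rightarrow> (real ^ 'd) set set" where
  "simplicial_cones A =
     {pos_cone A s | s. card s = CARD('d) \<and> dim (rcol A ` s) = CARD('d)}"

definition chamber_complex :: "int ^ 'n ^ 'd \<Rightarrow> (real ^ 'd) set set" where
  "chamber_complex A =
     {F. F \<noteq> {} \<and> (\<exists>b \<in> pos_cone A UNIV. F face_of \<Inter>{C \<in> simplicial_cones A. b \<in> C})}"

definition chamber :: "int ^ 'n ^ 'd \<Rightarrow> (real ^ 'd) set \<Rightarrow> bool" where
  "chamber A \<gamma> \<longleftrightarrow> \<gamma> \<in> chamber_complex A \<and> aff_dim \<gamma> = int CARD('d)"

definition external_column :: "int ^ 'n ^ 'd \<Rightarrow> 'n \<Rightarrow> bool" where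
  "external_column A j \<longleftrightarrow> rcol A j \<notin> pos_cone A (UNIV - {j})"

definition rays :: "(real ^ 'd) set \<Rightarrow> (real ^ 'd) set set" where
  "rays C = {R. R face_of C \<and> aff_dim R = 1}"

definition external_columns_of :: "int ^ 'n ^ 'd \<Rightarrow> (real ^ 'd) set \<Rightarrow> 'n set" where
  "external_columns_of A \<gamma> = {j. external_column A j \<and> pos_cone A {j} \<in> rays \<gamma>}"

definition external_chamber :: "int ^ 'n ^ 'd \<Rightarrow> (real ^ 'd) set \<Rightarrow> bool" where
  "external_chamber A \<gamma> \<longleftrightarrow> chamber A \<gamma> \<and>
     (\<exists>!R. R \<in> rays \<gamma> \<and> \<not> (\<exists>j. external_column A j \<and> R = pos_cone A {j}))"

definition external_facet :: "int ^ 'n ^ 'd \<Rightarrow> (real ^ 'd) set \<Rightarrow> (real ^ 'd) set" where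
  "external_facet A \<gamma> = pos_cone A (external_columns_of A \<gamma>)"

text \<open>For a full-dimensional cone \<open>C\<close> this determines \<open>\<iota>\<close> uniquely.\<close>

definition min_inner_facet_normal ::
    "(real ^ 'd) set \<Rightarrow> (real ^ 'd) set \<Rightarrow> int ^ 'd \<Rightarrow> bool" where
  "min_inner_facet_normal C f \<iota> \<longleftrightarrow> f facet_of C \<and> Gcd (range (($) \<iota>)) = 1 \<and>
     (\<forall>x\<in>f. rvec \<iota> \<bullet> x = 0) \<and> (\<forall>x\<in>C. 0 \<le> rvec \<iota> \<bullet> x)"

definition col_lattice :: "int ^ 'n ^ 'd \<Rightarrow> (int ^ 'd) set" where
  "col_lattice A = {A *v z | z. True}"

definition col_semigroup :: "int ^ 'n ^ 'd \<Rightarrow> 'n set \<Rightarrow> (int ^ 'd) set" where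
  "col_semigroup A s = {\<Sum>j\<in>s. int (c j) *s column j A | c. True}"

definition saturated :: "int ^ 'n ^ 'd \<Rightarrow> 'n set \<Rightarrow> bool" where
  "saturated A s \<longleftrightarrow> col_semigroup A s = {b \<in> col_lattice A. rvec b \<in> pos_cone A s}"

definition vector_partition :: "int ^ 'n ^ 'd \<Rightarrow> int ^ 'd \<Rightarrow> nat" where
  "vector_partition A b = card {x :: nat ^ 'n. A *v nvec x = b}"

definition polynomial_on :: "(int ^ 'd) set \<Rightarrow> (int ^ 'd \<Rightarrow> real) \<Rightarrow> bool" where
  "polynomial_on X q \<longleftrightarrow>
     (\<exists>P. real_polynomial_function P \<and> (\<forall>b\<in>X. q b = P (rvec b)))"

definition quasi_polynomial :: "(int ^ 'd \<Rightarrow> real) \<Rightarrow> bool" where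
  "quasi_polynomial q \<longleftrightarrow>
     (\<exists>N>0. \<forall>r. polynomial_on {b. \<forall>i. b $ i mod N = r $ i mod N} q)"

text \<open>The quasi-polynomial \<open>p\<^sub>A\<^sup>\<gamma>\<close> exists by the theorems of Blakley and Sturmfels and is unique
  for a full-dimensional \<open>\<gamma>\<close>; it is characterised here as a predicate on functions on the
  integer lattice.\<close>

definition chamber_quasi_polynomial ::
    "int ^ 'n ^ 'd \<Rightarrow> (real ^ 'd) set \<Rightarrow> (int ^ 'd \<Rightarrow> real) \<Rightarrow> bool" where
  "chamber_quasi_polynomial A \<gamma> p \<longleftrightarrow> quasi_polynomial p \<and>
     (\<forall>b. rvec b \<in> \<gamma> \<longrightarrow> p b = real (vector_partition A b))"

text \<open>The matrix with columns \<open>a\<^bsub>\<sigma> k\<^esub>\<close> for \<open>k \<noteq> e\<close> and \<open>b\<close> in position \<open>e\<close>; its determinant is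
  \<open>det (a\<^sub>1, \<dots>, a\<^bsub>d-1\<^esub>, b)\<close> up to a sign depending only on the labelling.\<close>

definition bordered :: "int ^ 'n ^ 'd \<Rightarrow> ('d \<Rightarrow> 'n) \<Rightarrow> 'd \<Rightarrow> int ^ 'd \<Rightarrow> int ^ 'd ^ 'd" where
  "bordered A \<sigma> e b = (\<chi> i k. if k = e then b $ i else A $ i $ \<sigma> k)"

end

theory Submission
  imports Defs
begin

text \<open>
  Let \<open>E\<close> index the external columns of \<open>\<gamma>\<close>. Every simplicial cone that contains the point defining
  \<open>\<gamma>\<close> contains the external columns, hence is spanned by them and one further column. Exchanging that
  column by the ratio test shows that \<open>\<iota>\<close> is positive on each column \<open>a\<^sub>j\<close> outside \<open>E\<close> and that \<open>\<gamma>\<close> lies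
  in the cone generated by the external facet and \<open>a\<^sub>j\<close>. With saturation, the vector partition function
  on \<open>\<gamma>\<close> therefore counts the representations of \<open>\<iota> \<bullet> b\<close> as a sum of the parts \<open>\<beta>\<^sub>j = \<iota> \<bullet> a\<^sub>j\<close>. If
  all parts equal \<open>\<beta>\<close>, this number is a binomial coefficient. Conversely, polynomiality makes it a
  polynomial along each progression of step \<open>\<beta>\<^sub>j\<close>, so multiplying its generating function, the
  reciprocal of the product of the \<open>1 - X ^ \<beta>\<^sub>k\<close>, by a power of \<open>1 - X ^ \<beta>\<^sub>j\<close> gives a polynomial; comparing
  roots, each \<open>\<beta>\<^sub>k\<close> divides \<open>\<beta>\<^sub>j\<close>.
\<close>

subsection \<open>Counting representations by parts\<close>

text \<open>A solution is a total function, so the values off \<open>J\<close> are pinned to 0 to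
  make different functions stand for different solutions. Parts are labelled: equal parts with
  different labels are counted apart, as repeated columns are.\<close>

definition solutions :: "'n set \<Rightarrow> ('n \<Rightarrow> nat) \<Rightarrow> nat \<Rightarrow> ('n \<Rightarrow> nat) set" where
  "solutions J \<beta> N = {y. (\<forall>j. j \<notin> J \<longrightarrow> y j = 0) \<and> (\<Sum>j\<in>J. y j * \<beta> j) = N}"

lemma finite_solutions:
  assumes "finite J" "\<And>j. j \<in> J \<Longrightarrow> 0 < \<beta> j"
  shows "finite (solutions J \<beta> N)"
proof (rule finite_subset)
  show "solutions J \<beta> N \<subseteq> {y. \<forall>j. (j \<in> J \<longrightarrow> y j \<in> {..N}) \<and> (j \<notin> J \<longrightarrow> y j = 0)}"
  proof
    fix y assume y: "y \<in> solutions J \<beta> N"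
    have "y j \<le> N" if j: "j \<in> J" for j
    proof -
      have "y j \<le> y j * \<beta> j" using assms(2)[OF j] by simp
      also have "\<dots> \<le> (\<Sum>j\<in>J. y j * \<beta> j)"
        using j assms(1) by (intro member_le_sum) auto
      finally show ?thesis using y by (simp add: solutions_def)
    qed
    then show "y \<in> {y. \<forall>j. (j \<in> J \<longrightarrow> y j \<in> {..N}) \<and> (j \<notin> J \<longrightarrow> y j = 0)}"
      using y by (auto simp: solutions_def)
  qed
  show "finite {y. \<forall>j. (j \<in> J \<longrightarrow> y j \<in> {..N}) \<and> (j \<notin> J \<longrightarrow> y j = 0)}"
    using finite_set_of_finite_funs[OF assms(1), of "{..N}" 0] by simp
qed

text \<open>Either part \<open>k\<close> does not occur, or one copy of it can be taken away. The
  guard is needed because subtraction on the naturals truncates at 0.\<close>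

lemma solutions_insert:
  assumes "finite J" "k \<notin> J" "0 < \<beta> k"
  shows "solutions (insert k J) \<beta> N = solutions J \<beta> N \<union>
    (if N < \<beta> k then {} else (\<lambda>y. y(k := Suc (y k))) ` solutions (insert k J) \<beta> (N - \<beta> k))"
    (is "?L = _ \<union> ?R")
proof (intro equalityI subsetI)
  have upd: "(\<Sum>j\<in>J. (z(k := c)) j * \<beta> j) = (\<Sum>j\<in>J. z j * \<beta> j)" for z c
    using assms(2) by (intro sum.cong) auto
  {
    fix y assume y: "y \<in> ?L"
    show "y \<in> solutions J \<beta> N \<union> ?R"
    proof (cases "y k")
      case 0
      then have "y \<in> solutions J \<beta> N"
        using y assms by (auto simp: solutions_def) (metis)
      then show ?thesis by simp
    next
      case (Suc c)
      have N: "N = Suc c * \<beta> k + (\<Sum>j\<in>J. y j * \<beta> j)"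
        using y assms Suc by (auto simp: solutions_def)
      have "y(k := c) \<in> solutions (insert k J) \<beta> (N - \<beta> k)"
        using y assms N upd[of y c] by (auto simp: solutions_def simp del: fun_upd_apply) auto
      moreover have "y = (\<lambda>y. y(k := Suc (y k))) (y(k := c))" using Suc by auto
      ultimately have "y \<in> (\<lambda>y. y(k := Suc (y k))) ` solutions (insert k J) \<beta> (N - \<beta> k)"
        by blast
      then show ?thesis using N by simp
    qed
  next
    fix y assume y: "y \<in> solutions J \<beta> N \<union> ?R"
    show "y \<in> ?L"
    proof (cases "y \<in> solutions J \<beta> N")
      case True
      then show ?thesis using assms by (auto simp: solutions_def)
    next
      case False
      then obtain z where z: "z \<in> solutions (insert k J) \<beta> (N - \<beta> k)" "y = z(k := Suc (z k))"
        and N: "\<beta> k \<le> N" using y by (auto split: if_splits)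
      have "(\<Sum>j\<in>insert k J. y j * \<beta> j) = \<beta> k + (\<Sum>j\<in>insert k J. z j * \<beta> j)"
        using assms upd[of z "Suc (z k)"] by (simp add: z(2) del: fun_upd_apply) simp
      then show ?thesis using z N by (auto simp: solutions_def)
    qed
  }
qed

lemma card_solutions_insert:
  assumes "finite J" "k \<notin> J" "\<And>j. j \<in> insert k J \<Longrightarrow> 0 < \<beta> j"
  shows "card (solutions (insert k J) \<beta> N) = card (solutions J \<beta> N) +
    (if N < \<beta> k then 0 else card (solutions (insert k J) \<beta> (N - \<beta> k)))"
proof -
  let ?u = "\<lambda>y. y(k := Suc (y k))"
  have inj: "inj_on ?u X" for X :: "('a \<Rightarrow> nat) set"
  proof (rule inj_onI)
    fix x y :: "'a \<Rightarrow> nat" assume eq: "?u x = ?u y"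
    have "x j = y j" for j using fun_cong[OF eq, of j] by (cases "j = k") auto
    then show "x = y" by auto
  qed
  have disj: "solutions J \<beta> N \<inter> ?u ` solutions (insert k J) \<beta> (N - \<beta> k) = {}"
    using assms(2) by (auto simp: solutions_def)
  have fin: "finite (solutions J \<beta> N)" "finite (solutions (insert k J) \<beta> (N - \<beta> k))"
    using assms by (auto intro!: finite_solutions)
  show ?thesis
    using solutions_insert[OF assms(1,2), of \<beta> N] assms(3)[of k] disj fin
    by (simp add: card_Un_disjoint card_image[OF inj])
qed

text \<open>For equal parts the recursion on the last part is Pascal's rule, whence an inner
  induction on \<open>N\<close> inside the induction on \<open>J\<close>. A single part is the base
  case, which matches the lower index \<open>card J - 1\<close>.\<close>

lemma card_solutions_const:
  assumes "finite J" "J \<noteq> {}" "\<And>j. j \<in> J \<Longrightarrow> \<beta> j = (b::nat)" "0 < b"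
  shows "card (solutions J \<beta> (b * N)) = (N + (card J - 1)) choose (card J - 1)"
  using assms(1-3)
proof (induction J arbitrary: N rule: finite_ne_induct)
  case (singleton k)
  then have "solutions {k} \<beta> (b * N) = {(\<lambda>_. 0)(k := N)}"
    using assms(4) by (auto simp: solutions_def fun_eq_iff)
  then show ?case by simp
next
  case (insert k J)
  have c: "card J = Suc (card J - 1)" using insert.hyps by (cases "card J") auto
  have rec: "card (solutions (insert k J) \<beta> M) = card (solutions J \<beta> M) +
      (if M < b then 0 else card (solutions (insert k J) \<beta> (M - b)))" for M
    using card_solutions_insert[of J k \<beta> M] insert.hyps insert.prems assms(4) by auto
  show ?case
  proof (induction N)
    case 0
    show ?case using rec[of 0] insert.IH[of 0] insert.prems assms(4) by simp
  next
    case (Suc N)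
    show ?case using rec[of "b * Suc N"] insert.IH[of "Suc N"] Suc insert.prems insert.hyps c
      by simp (metis binomial_Suc_Suc)
  qed
qed

section \<open>Generating functions and divisibility of the parts\<close>

text \<open>Multiplying by \<open>1 - fps_X ^ \<beta> k\<close> removes part \<open>k\<close> from
  the count, by the recursion. The product form avoids division and holds over any integral
  domain.\<close>

lemma fps_card_solutions:
  assumes "finite J" "\<And>j. j \<in> J \<Longrightarrow> 0 < \<beta> j"
  shows "(\<Prod>k\<in>J. 1 - fps_X ^ \<beta> k) * Abs_fps (\<lambda>N. of_nat (card (solutions J \<beta> N)))
    = (1 :: 'a::idom fps)"
  using assms
proof (induction J rule: finite_induct)
  case empty
  have "Abs_fps (\<lambda>N. of_nat (card (solutions {} \<beta> N))) = (1 :: 'a fps)"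
  proof (rule fps_ext)
    fix N
    have "solutions {} \<beta> N = (if N = 0 then {\<lambda>_. 0} else {})"
      by (auto simp: solutions_def)
    then show "fps_nth (Abs_fps (\<lambda>N. of_nat (card (solutions {} \<beta> N)))) N = fps_nth (1 :: 'a fps) N" by simp
  qed
  then show ?case by simp
next
  case (insert k J)
  have "(1 - fps_X ^ \<beta> k) * Abs_fps (\<lambda>N. of_nat (card (solutions (insert k J) \<beta> N)))
      = (Abs_fps (\<lambda>N. of_nat (card (solutions J \<beta> N))) :: 'a fps)"
    using card_solutions_insert[OF insert.hyps(1,2) insert.prems]
    by (intro fps_ext) (simp add: left_diff_distrib fps_X_power_mult_nth)
  then have "(\<Prod>k\<in>J. 1 - fps_X ^ \<beta> k) * ((1 - fps_X ^ \<beta> k) *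
      Abs_fps (\<lambda>N. of_nat (card (solutions (insert k J) \<beta> N)))) = (1 :: 'a fps)"
    using insert by simp
  then show ?case using insert.hyps by (simp add: mult_ac)
qed

text \<open>A backward difference lowers the degree, since shifting the argument keeps the leading
  coefficient. Bounding the degree by vanishing coefficients lets the bound \<open>D = 0\<close>
  express the zero polynomial.\<close>

lemma coeff_diff_shift_eq_0:
  fixes c :: "'a::idom poly"
  assumes "\<forall>i\<ge>Suc D. coeff c i = 0"
  shows "\<forall>i\<ge>D. coeff (c - pcompose c [:-1, 1:]) i = 0"
proof (intro allI impI)
  fix i assume i: "D \<le> i"
  have deg: "degree c \<le> D" using assms by (simp add: degree_le)
  have deg': "degree (pcompose c [:-1, 1:]) = degree c" by (simp add: degree_pcompose)
  show "coeff (c - pcompose c [:-1, 1:]) i = 0"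
  proof (cases "degree c = i")
    case True
    then show ?thesis using lead_coeff_comp[of "[:-1, 1:]" c] deg' by simp
  next
    case False
    then show ?thesis using deg deg' i by (simp add: coeff_eq_0)
  qed
qed

text \<open>Each factor \<open>1 - fps_X ^ b\<close> takes backward differences of step
  \<open>b\<close> in all residue classes at once and lowers the degree bound by one. After
  \<open>D\<close> factors every class is eventually zero, and there are finitely many
  classes.\<close>

lemma fps_annihilate_eventually_polynomial:
  fixes f :: "nat \<Rightarrow> 'a::{idom,ring_char_0}"
  assumes "0 < b"
    and "\<And>s. \<exists>c M. (\<forall>i\<ge>D. coeff c i = 0) \<and> (\<forall>N\<ge>M. f (s + N * b) = poly c (of_nat N))"
  shows "\<exists>M. \<forall>s\<ge>M. fps_nth ((1 - fps_X ^ b) ^ D * Abs_fps f) s = 0"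
  using assms(2)
proof (induction D arbitrary: f)
  case 0
  have "\<exists>M. \<forall>N\<ge>M. f (s + N * b) = 0" for s
  proof -
    obtain c M where "\<forall>i. coeff c i = 0" "\<forall>N\<ge>M. f (s + N * b) = poly c (of_nat N)"
      using 0[of s] by auto
    then show ?thesis by (metis poly_0 poly_eqI coeff_0)
  qed
  then obtain M where M: "\<And>s N. N \<ge> M s \<Longrightarrow> f (s + N * b) = 0" by metis
  \<comment> \<open>The sum stands in for the maximum of the thresholds \<open>M s\<close> over the
    residues \<open>s < b\<close>; beyond \<open>K\<close> the quotient \<open>s div b\<close>
    exceeds each of them.\<close>
  define K where "K = b * Suc (\<Sum>s<b. M s)"
  have "f s = 0" if "s \<ge> K" for s
  proof -
    have "M (s mod b) \<le> (\<Sum>s<b. M s)" using assms(1) by (intro member_le_sum) auto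
    also have "\<dots> \<le> s div b"
      using that assms(1) by (simp add: K_def less_eq_div_iff_mult_less_eq mult.commute)
    finally show ?thesis using M[of "s mod b" "s div b"] by simp
  qed
  then show ?case by auto
next
  case (Suc D)
  define g where "g s = f s - (if s < b then 0 else f (s - b))" for s
  have g: "(1 - fps_X ^ b) * Abs_fps f = Abs_fps g"
    by (intro fps_ext) (simp add: left_diff_distrib fps_X_power_mult_nth g_def)
  have "\<exists>M. \<forall>s\<ge>M. fps_nth ((1 - fps_X ^ b) ^ D * Abs_fps g) s = 0"
  proof (rule Suc.IH)
    fix s
    obtain c M where c: "\<forall>i\<ge>Suc D. coeff c i = 0"
      and M: "\<And>N. N \<ge> M \<Longrightarrow> f (s + N * b) = poly c (of_nat N)"
      using Suc.prems[of s] by auto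
    \<comment> \<open>The threshold grows by one because the difference also looks at the preceding
      term of the progression.\<close>
    have "g (s + N * b) = poly (c - pcompose c [:-1, 1:]) (of_nat N)" if N: "N \<ge> Suc M" for N
    proof -
      obtain N' where N': "N = Suc N'" "N' \<ge> M" using N by (cases N) auto
      have "s + N * b - b = s + N' * b" by (simp add: N')
      then show ?thesis using M[OF N'(2)] M[of N] N'
        by (simp add: g_def poly_pcompose)
    qed
    then show "\<exists>c M. (\<forall>i\<ge>D. coeff c i = 0) \<and> (\<forall>N\<ge>M. g (s + N * b) = poly c (of_nat N))"
      using coeff_diff_shift_eq_0[OF c] by blast
  qed
  then show ?case using g by (simp add: mult.assoc power_Suc2 del: power_Suc)
qed

text \<open>The number \<open>cis (2 * pi / k)\<close> is a primitive root of unity of order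
  \<open>k\<close>.\<close>

lemma dvd_of_root_of_unity:
  fixes k b :: nat
  assumes "0 < k" "cis (2 * pi / k) ^ b = 1"
  shows "k dvd b"
proof -
  have "cis (real b * (2 * pi / k)) = 1" using assms(2) by (simp only: Complex.DeMoivre)
  then have "cos (real b * (2 * pi / k)) = 1" by (simp add: complex_eq_iff)
  then obtain n :: int where "real b * (2 * pi / k) = real_of_int n * 2 * pi" using cos_one_2pi_int by blast
  then have "real b = real_of_int n * real k" using assms(1) by (simp add: field_simps)
  then have "int b = n * int k" by (metis of_int_eq_iff of_int_mult of_int_of_nat_eq)
  then show ?thesis by (metis dvd_triv_right int_dvd_int_iff)
qed

text \<open>The hypothesis is confined to representable \<open>s\<close>, because values at points
  of the semigroup say nothing about other \<open>s\<close>. The coefficients are complex so that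
  roots of unity can be substituted.\<close>

lemma parts_dvd_of_polynomial_in_classes:
  assumes J: "finite J" "\<And>j. j \<in> J \<Longrightarrow> 0 < \<beta> j" "j \<in> J" "k \<in> J"
    and poly: "\<And>s. solutions J \<beta> s \<noteq> {} \<Longrightarrow> \<exists>c :: complex poly. (\<forall>i\<ge>D. coeff c i = 0) \<and>
      (\<forall>N. of_nat (card (solutions J \<beta> (s + N * \<beta> j))) = poly c (of_nat N))"
  shows "\<beta> k dvd \<beta> j"
proof -
  define F :: "complex fps" where "F = Abs_fps (\<lambda>N. of_nat (card (solutions J \<beta> N)))"
  have "\<exists>M. \<forall>s\<ge>M. fps_nth ((1 - fps_X ^ \<beta> j) ^ D * F) s = 0"
    unfolding F_def
  proof (rule fps_annihilate_eventually_polynomial)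
    show "0 < \<beta> j" using J by simp
    fix s
    show "\<exists>c M. (\<forall>i\<ge>D. coeff c i = 0) \<and>
      (\<forall>N\<ge>M. of_nat (card (solutions J \<beta> (s + N * \<beta> j))) = poly c (of_nat N :: complex))"
    proof (cases "\<exists>N. solutions J \<beta> (s + N * \<beta> j) \<noteq> {}")
      case False
      then show ?thesis by (intro exI[of _ 0]) auto
    next
      case True
      then obtain M where "solutions J \<beta> (s + M * \<beta> j) \<noteq> {}" by blast
      from poly[OF this] obtain c :: "complex poly" where c: "\<forall>i\<ge>D. coeff c i = 0"
        "\<And>N. of_nat (card (solutions J \<beta> (s + M * \<beta> j + N * \<beta> j))) = poly c (of_nat N)" by blast
      \<comment> \<open>Polynomiality starts at the representable term with index \<open>M\<close>;
        substituting \<open>N - M\<close> turns it into a polynomial in the original index.\<close>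
      have "of_nat (card (solutions J \<beta> (s + N * \<beta> j))) = poly (pcompose c [:- of_nat M, 1:]) (of_nat N)"
        if "N \<ge> M" for N
        using c(2)[of "N - M"] that
        by (simp add: poly_pcompose add.assoc flip: add_mult_distrib)
      moreover have "coeff (pcompose c [:- of_nat M, 1:]) i = 0" if "i \<ge> D" for i
      proof (cases "c = 0")
        case False
        have "degree c < D" using c(1) False by (metis leading_coeff_0_iff not_less)
        then show ?thesis using that by (intro coeff_eq_0) (simp add: degree_pcompose)
      qed simp
      ultimately show ?thesis by blast
    qed
  qed
  then obtain M where M: "\<And>s. s \<ge> M \<Longrightarrow> fps_nth ((1 - fps_X ^ \<beta> j) ^ D * F) s = 0" by blast
  \<comment> \<open>All coefficients from \<open>M\<close> on vanish, so truncation loses nothing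
    and the power series is a polynomial.\<close>
  define G where "G = truncate_fps M ((1 - fps_X ^ \<beta> j) ^ D * F)"
  have G: "fps_of_poly G = (1 - fps_X ^ \<beta> j) ^ D * F"
    using M by (intro fps_ext) (auto simp: G_def coeff_truncate_fps not_less)
  have "fps_of_poly ((1 - monom 1 (\<beta> j)) ^ D)
    = (1 - fps_X ^ \<beta> j) ^ D * ((\<Prod>k\<in>J. 1 - fps_X ^ \<beta> k) * F)"
    using fps_card_solutions[OF J(1,2), where ?'a = complex]
    by (simp add: F_def fps_of_poly_power fps_of_poly_diff fps_of_poly_monom')
  also have "\<dots> = fps_of_poly (G * (\<Prod>k\<in>J. 1 - monom 1 (\<beta> k)))"
    by (simp add: fps_of_poly_mult fps_of_poly_prod fps_of_poly_diff fps_of_poly_monom' G mult_ac)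
  finally have eq: "(1 - monom 1 (\<beta> j)) ^ D = G * (\<Prod>k\<in>J. 1 - monom 1 (\<beta> k))"
    by (simp only: fps_of_poly_eq_iff)
  let ?w = "cis (2 * pi / \<beta> k)"
  have "?w ^ \<beta> k = cis (2 * pi)" using J(2)[OF J(4)] by (simp only: Complex.DeMoivre) simp
  then have "?w ^ \<beta> k = 1" by simp
  then have "poly (\<Prod>k\<in>J. 1 - monom 1 (\<beta> k)) ?w = 0"
    using J by (auto simp: poly_prod poly_monom)
  then have "poly ((1 - monom 1 (\<beta> j)) ^ D) ?w = 0" by (simp add: eq)
  then have "?w ^ \<beta> j = 1" by (simp add: poly_monom)
  then show ?thesis using dvd_of_root_of_unity J by blast
qed

section \<open>Polynomial functions on lines\<close>

text \<open>The point is that \<open>D\<close> is uniform in the line: the number of differences to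
  take must be fixed before the progression is chosen.\<close>

lemma real_polynomial_function_along_lines:
  assumes "real_polynomial_function P"
  shows "\<exists>D. \<forall>u w. \<exists>c :: complex poly. (\<forall>i\<ge>D. coeff c i = 0) \<and>
    (\<forall>t. complex_of_real (P (u + t *\<^sub>R w)) = poly c (of_real t))"
  using assms
proof induction
  case (linear f)
  then interpret bounded_linear f .
  show ?case
  proof (rule exI[of _ 2], intro allI)
    fix u w
    show "\<exists>c :: complex poly. (\<forall>i\<ge>2. coeff c i = 0) \<and>
      (\<forall>t. complex_of_real (f (u + t *\<^sub>R w)) = poly c (of_real t))"
      by (intro exI[of _ "[:of_real (f u), of_real (f w):]"])
        (auto simp: add scaleR coeff_pCons split: nat.splits)
  qed
next
  case (const a)
  show ?case
    by (intro exI[of _ 1] allI exI[of _ "[:of_real a:]"]) (auto simp: coeff_pCons split: nat.splits)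
next
  case (add f g)
  then obtain D D' where
    D: "\<And>u w. \<exists>c :: complex poly. (\<forall>i\<ge>D. coeff c i = 0) \<and>
      (\<forall>t. complex_of_real (f (u + t *\<^sub>R w)) = poly c (of_real t))" and
    D': "\<And>u w. \<exists>c :: complex poly. (\<forall>i\<ge>D'. coeff c i = 0) \<and>
      (\<forall>t. complex_of_real (g (u + t *\<^sub>R w)) = poly c (of_real t))" by metis
  show ?case
  proof (intro exI[of _ "max D D'"] allI)
    fix u w
    obtain c c' where "\<forall>i\<ge>D. coeff c i = 0" "\<forall>i\<ge>D'. coeff c' i = 0"
      "\<forall>t. complex_of_real (f (u + t *\<^sub>R w)) = poly c (of_real t)"
      "\<forall>t. complex_of_real (g (u + t *\<^sub>R w)) = poly c' (of_real t)"
      using D[of u w] D'[of u w] by blast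
    then show "\<exists>c. (\<forall>i\<ge>max D D'. coeff c i = 0) \<and>
      (\<forall>t. complex_of_real (f (u + t *\<^sub>R w) + g (u + t *\<^sub>R w)) = poly c (of_real t))"
      by (intro exI[of _ "c + c'"]) auto
  qed
next
  case (mult f g)
  then obtain D D' where
    D: "\<And>u w. \<exists>c :: complex poly. (\<forall>i\<ge>D. coeff c i = 0) \<and>
      (\<forall>t. complex_of_real (f (u + t *\<^sub>R w)) = poly c (of_real t))" and
    D': "\<And>u w. \<exists>c :: complex poly. (\<forall>i\<ge>D'. coeff c i = 0) \<and>
      (\<forall>t. complex_of_real (g (u + t *\<^sub>R w)) = poly c (of_real t))" by metis
  show ?case
  proof (intro exI[of _ "Suc (D + D')"] allI)
    fix u w
    obtain c c' where c: "\<forall>i\<ge>D. coeff c i = 0" "\<forall>i\<ge>D'. coeff c' i = 0"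
      "\<forall>t. complex_of_real (f (u + t *\<^sub>R w)) = poly c (of_real t)"
      "\<forall>t. complex_of_real (g (u + t *\<^sub>R w)) = poly c' (of_real t)"
      using D[of u w] D'[of u w] by blast
    have "degree c \<le> D" "degree c' \<le> D'" using c(1,2) by (auto intro!: degree_le)
    then have "degree (c * c') \<le> D + D'" using degree_mult_le[of c c'] by linarith
    then have "\<forall>i\<ge>Suc (D + D'). coeff (c * c') i = 0" by (auto intro!: coeff_eq_0)
    then show "\<exists>c. (\<forall>i\<ge>Suc (D + D'). coeff c i = 0) \<and>
      (\<forall>t. complex_of_real (f (u + t *\<^sub>R w) * g (u + t *\<^sub>R w)) = poly c (of_real t))"
      using c(3,4) by (intro exI[of _ "c * c'"]) auto
  qed
qed

text \<open>A polynomial in one variable that takes one value at infinitely many integers is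
  constant. This carries information from deep inside the chamber back to a point \<open>u\<close>
  that may lie outside it.\<close>

lemma real_polynomial_function_eventually_const:
  assumes P: "real_polynomial_function P"
    and const: "\<And>N::nat. N \<ge> M \<Longrightarrow> P (u + real N *\<^sub>R w) = K"
  shows "P u = K"
proof -
  obtain c :: "complex poly" where
    c: "\<And>t. complex_of_real (P (u + t *\<^sub>R w)) = poly c (of_real t)"
    using real_polynomial_function_along_lines[OF P] by metis
  have "of_nat ` {M..} \<subseteq> {z. poly (c - [:of_real K:]) z = 0}"
    using const c by auto (metis of_real_of_nat_eq)
  moreover have "infinite (of_nat ` {M..} :: complex set)"
    by (simp add: finite_image_iff inj_on_def infinite_Ici)
  ultimately have "c - [:of_real K:] = 0"
    using poly_roots_finite finite_subset by blast
  then have "poly c 0 = of_real K" by simp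
  then show ?thesis using c[of 0] by (metis of_real_0 of_real_eq_iff scaleR_zero_left add.right_neutral)
qed

subsection \<open>Cones and chambers\<close>

lemma rvec_add: "rvec (u + v) = rvec u + rvec v"
  by (simp add: rvec_def vec_eq_iff)

lemma rvec_sum: "rvec (\<Sum>j\<in>s. v j) = (\<Sum>j\<in>s. rvec (v j))"
  by (simp add: rvec_def vec_eq_iff)

lemma rvec_scale: "rvec (k *s v) = real_of_int k *\<^sub>R rvec v"
  by (simp add: rvec_def vec_eq_iff)

lemma rvec_inject: "rvec u = rvec v \<longleftrightarrow> u = v"
  by (simp add: rvec_def vec_eq_iff)

lemma rvec_inner: "rvec u \<bullet> rvec v = real_of_int (\<Sum>i\<in>UNIV. u $ i * v $ i)"
  by (simp add: rvec_def inner_vec_def)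

lemma rvec_mult_nvec: "rvec (A *v nvec x) = (\<Sum>j\<in>UNIV. real (x $ j) *\<^sub>R rcol A j)"
  by (simp add: rvec_def nvec_def rcol_def column_def matrix_vector_mult_def vec_eq_iff mult.commute)

lemma pos_coneI: "(\<And>j. j \<in> s \<Longrightarrow> 0 \<le> c j) \<Longrightarrow> (\<Sum>j\<in>s. c j *\<^sub>R rcol A j) \<in> pos_cone A s"
  unfolding pos_cone_def by blast

lemma pos_coneE:
  assumes "x \<in> pos_cone A s"
  obtains c where "x = (\<Sum>j\<in>s. c j *\<^sub>R rcol A j)" "\<And>j. j \<in> s \<Longrightarrow> 0 \<le> c j"
  using assms unfolding pos_cone_def by blast

lemma pos_cone_add: "x \<in> pos_cone A s \<Longrightarrow> y \<in> pos_cone A s \<Longrightarrow> x + y \<in> pos_cone A s"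
proof (elim pos_coneE)
  fix c c' assume "x = (\<Sum>j\<in>s. c j *\<^sub>R rcol A j)" "y = (\<Sum>j\<in>s. c' j *\<^sub>R rcol A j)"
    and nonneg: "\<And>j. j \<in> s \<Longrightarrow> 0 \<le> c j" "\<And>j. j \<in> s \<Longrightarrow> 0 \<le> c' j"
  then have "x + y = (\<Sum>j\<in>s. (c j + c' j) *\<^sub>R rcol A j)"
    by (simp add: scaleR_add_left sum.distrib)
  then show ?thesis using pos_coneI[of s "\<lambda>j. c j + c' j" A] nonneg by (metis add_nonneg_nonneg)
qed

lemma pos_cone_scale: "x \<in> pos_cone A s \<Longrightarrow> 0 \<le> t \<Longrightarrow> t *\<^sub>R x \<in> pos_cone A s"
proof (elim pos_coneE)
  fix c assume "x = (\<Sum>j\<in>s. c j *\<^sub>R rcol A j)" "0 \<le> t"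
    and nonneg: "\<And>j. j \<in> s \<Longrightarrow> 0 \<le> c j"
  then have "t *\<^sub>R x = (\<Sum>j\<in>s. (t * c j) *\<^sub>R rcol A j)"
    by (simp add: scaleR_sum_right)
  then show ?thesis using pos_coneI[of s "\<lambda>j. t * c j" A] nonneg \<open>0 \<le> t\<close>
    by (metis mult_nonneg_nonneg)
qed

lemma zero_mem_pos_cone: "0 \<in> pos_cone A s"
  using pos_coneI[of s "\<lambda>_. 0" A] by simp

lemma pos_cone_sum:
  "(\<And>k. k \<in> T \<Longrightarrow> x k \<in> pos_cone A s) \<Longrightarrow> (\<Sum>k\<in>T. x k) \<in> pos_cone A s"
  by (induction T rule: infinite_finite_induct) (auto simp: zero_mem_pos_cone pos_cone_add)

lemma pos_cone_mono:
  fixes A :: "int ^ 'n ^ 'd"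
  assumes "s \<subseteq> t" shows "pos_cone A s \<subseteq> pos_cone A t"
proof
  fix x assume "x \<in> pos_cone A s"
  then obtain c where c: "x = (\<Sum>j\<in>s. c j *\<^sub>R rcol A j)" "\<And>j. j \<in> s \<Longrightarrow> 0 \<le> c j"
    by (blast elim: pos_coneE)
  have "x = (\<Sum>j\<in>t. (if j \<in> s then c j else 0) *\<^sub>R rcol A j)"
    using assms by (simp add: c(1) if_distrib[of "\<lambda>z. z *\<^sub>R _"] sum.inter_restrict[symmetric]
      Int_absorb1 cong: if_cong)
  moreover have "\<dots> \<in> pos_cone A t" using c(2) by (intro pos_coneI) auto
  ultimately show "x \<in> pos_cone A t" by simp
qed

lemma rcol_mem_pos_cone: "j \<in> s \<Longrightarrow> rcol A j \<in> pos_cone A s" for A :: "int ^ 'n ^ 'd"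
  using pos_coneI[of "{j}" "\<lambda>_. 1" A] pos_cone_mono[of "{j}" s A] by auto

lemma convex_pos_cone: "convex (pos_cone A s)"
  by (auto simp: convex_def intro!: pos_cone_add pos_cone_scale)

section \<open>Bases of columns and the exchange step\<close>

text \<open>This is the condition on \<open>s\<close> in \<open>simplicial_cones\<close>. Equality
  of both numbers with \<open>CARD('d)\<close> also forces the columns indexed by \<open>s\<close>
  to be distinct.\<close>

definition column_basis :: "int ^ 'n ^ 'd \<Rightarrow> 'n set \<Rightarrow> bool" where
  "column_basis A s \<longleftrightarrow> card s = CARD('d) \<and> dim (rcol A ` s) = CARD('d)"

lemma column_basis_props:
  fixes A :: "int ^ 'n ^ 'd"
  assumes "column_basis A s"
  shows column_basis_inj: "inj_on (rcol A) s"
    and column_basis_independent: "independent (rcol A ` s)"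
    and column_basis_span: "span (rcol A ` s) = UNIV"
proof -
  have s: "card s = CARD('d)" "dim (rcol A ` s) = CARD('d)"
    using assms by (auto simp: column_basis_def)
  have "card (rcol A ` s) \<le> card s" by (simp add: card_image_le)
  moreover have "dim (rcol A ` s) \<le> card (rcol A ` s)" by (simp add: dim_le_card')
  ultimately show inj: "inj_on (rcol A) s" using s by (intro eq_card_imp_inj_on) auto
  show "independent (rcol A ` s)"
    using s card_image[OF inj] by (intro card_le_dim_spanning[of _ "rcol A ` s"]) (auto simp: span_base)
  show "span (rcol A ` s) = UNIV"
    using s by (simp add: dim_eq_full[symmetric])
qed

lemma column_basis_coords:
  fixes A :: "int ^ 'n ^ 'd"
  assumes "column_basis A s"
  obtains c where "x = (\<Sum>j\<in>s. c j *\<^sub>R rcol A j)"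
proof -
  have "x \<in> span (rcol A ` s)" using column_basis_span[OF assms] by simp
  then obtain u where "x = (\<Sum>v\<in>rcol A ` s. u v *\<^sub>R v)"
    by (auto simp: span_finite)
  then have "x = (\<Sum>j\<in>s. u (rcol A j) *\<^sub>R rcol A j)"
    by (simp add: sum.reindex[OF column_basis_inj[OF assms]])
  then show thesis by (rule that)
qed

lemma column_basis_coords_unique:
  fixes A :: "int ^ 'n ^ 'd"
  assumes "column_basis A s" and eq: "(\<Sum>j\<in>s. c j *\<^sub>R rcol A j) = (\<Sum>j\<in>s. c' j *\<^sub>R rcol A j)"
    and j: "j \<in> s"
  shows "c j = c' j"
proof -
  have inj: "inj_on (rcol A) s" by (rule column_basis_inj[OF assms(1)])
  \<comment> \<open>Independence concerns a set of vectors, so the coefficients are moved from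
    indices to vectors along the inverse of \<open>rcol A\<close> on \<open>s\<close>.\<close>
  define u where "u v = c (the_inv_into s (rcol A) v) - c' (the_inv_into s (rcol A) v)" for v
  have "(\<Sum>v\<in>rcol A ` s. u v *\<^sub>R v) = (\<Sum>j\<in>s. (c j - c' j) *\<^sub>R rcol A j)"
    by (simp add: sum.reindex[OF inj] u_def the_inv_into_f_f[OF inj])
  also have "\<dots> = 0" using eq by (simp add: scaleR_left_diff_distrib sum_subtractf)
  finally have "u (rcol A j) = 0"
    using column_basis_independent[OF assms(1)] j by (auto simp: independent_explicit)
  then show ?thesis using j by (simp add: u_def the_inv_into_f_f[OF inj])
qed

text \<open>The ratio test of the simplex method: column \<open>j\<close> enters the basis \<open>s\<close>.\<close>

lemma pos_cone_pivot:
  fixes A :: "int ^ 'n ^ 'd"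
  assumes s: "column_basis A s" and b: "b \<in> pos_cone A s" and j: "j \<notin> s"
    and a: "rcol A j = (\<Sum>i\<in>s. \<nu> i *\<^sub>R rcol A i)" and pos: "\<exists>i\<in>s. 0 < \<nu> i"
  obtains k where "k \<in> s" "0 < \<nu> k" "column_basis A (insert j (s - {k}))"
    "b \<in> pos_cone A (insert j (s - {k}))"
proof -
  obtain l where l: "b = (\<Sum>i\<in>s. l i *\<^sub>R rcol A i)" "\<And>i. i \<in> s \<Longrightarrow> 0 \<le> l i"
    using b by (blast elim: pos_coneE)
  \<comment> \<open>The minimal ratio is the largest amount of column \<open>j\<close> that keeps
    all coefficients nonnegative; at that amount the coefficient of column \<open>k\<close> becomes
    0.\<close>
  define k where "k = arg_min_on (\<lambda>i. l i / \<nu> i) {i \<in> s. 0 < \<nu> i}"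
  have ne: "{i \<in> s. 0 < \<nu> i} \<noteq> {}" using pos by auto
  have k: "k \<in> s" "0 < \<nu> k"
    using arg_min_if_finite(1)[OF _ ne, of "\<lambda>i. l i / \<nu> i"] by (auto simp: k_def)
  have min: "l k / \<nu> k \<le> l i / \<nu> i" if "i \<in> s" "0 < \<nu> i" for i
    using arg_min_least[OF _ ne, of i "\<lambda>i. l i / \<nu> i"] that by (auto simp: k_def)
  define t where "t = l k / \<nu> k"
  have t: "0 \<le> t" using l(2)[OF k(1)] k(2) by (simp add: t_def)
  define c where "c i = (if i = j then t else l i - t * \<nu> i)" for i
  have nonneg: "0 \<le> l i - t * \<nu> i" if "i \<in> s" for i
  proof (cases "0 < \<nu> i")
    case True
    then show ?thesis using min[OF that True] by (simp add: t_def field_simps)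
  next
    case False
    then have "t * \<nu> i \<le> 0" using t by (simp add: mult_nonneg_nonpos)
    then show ?thesis using l(2)[OF that] by linarith
  qed
  have "b = t *\<^sub>R rcol A j + (\<Sum>i\<in>s. (l i - t * \<nu> i) *\<^sub>R rcol A i)"
    by (simp add: l(1) a scaleR_sum_right scaleR_left_diff_distrib sum_subtractf)
  also have "(\<Sum>i\<in>s. (l i - t * \<nu> i) *\<^sub>R rcol A i) = (\<Sum>i\<in>s - {k}. (l i - t * \<nu> i) *\<^sub>R rcol A i)"
    using k by (simp add: sum.remove t_def)
  also have "\<dots> = (\<Sum>i\<in>s - {k}. c i *\<^sub>R rcol A i)"
    using j by (intro sum.cong) (auto simp: c_def)
  also have "t *\<^sub>R rcol A j + \<dots> = (\<Sum>i\<in>insert j (s - {k}). c i *\<^sub>R rcol A i)"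
    using j by (simp add: c_def)
  also have "\<dots> \<in> pos_cone A (insert j (s - {k}))"
    using nonneg t by (intro pos_coneI) (auto simp: c_def)
  finally have b': "b \<in> pos_cone A (insert j (s - {k}))" .
  let ?s' = "insert j (s - {k})"
  have "card ?s' = card s" using j card_Suc_Diff1[of s k] k(1) by simp
  moreover have "dim (rcol A ` ?s') = CARD('d)"
  proof -
    \<comment> \<open>Solving the expansion of column \<open>j\<close> for column \<open>k\<close>
      shows that the new columns still span.\<close>
    have "rcol A k = (1 / \<nu> k) *\<^sub>R (rcol A j - (\<Sum>i\<in>s - {k}. \<nu> i *\<^sub>R rcol A i))"
      using k by (simp add: a sum.remove)
    also have "\<dots> \<in> span (rcol A ` ?s')"
      by (intro span_scale span_diff span_sum) (auto intro: span_base)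
    finally have "rcol A ` s \<subseteq> span (rcol A ` ?s')" by (auto intro: span_base)
    then have "span (rcol A ` ?s') = UNIV"
      using column_basis_span[OF s] span_minimal[of "rcol A ` s" "span (rcol A ` ?s')"] by auto
    then show ?thesis by (simp add: dim_eq_full[symmetric])
  qed
  ultimately have "column_basis A ?s'" using s by (simp add: column_basis_def)
  then show thesis using that k b' by blast
qed

text \<open>Extending the coefficients by 0 gives a nonnegative kernel vector of
  \<open>A\<close>.\<close>

lemma nonneg_combination_zero:
  fixes A :: "int ^ 'n ^ 'd"
  assumes kernel: "{x :: real ^ 'n. map_matrix real_of_int A *v x = 0 \<and> (\<forall>j. 0 \<le> x $ j)} = {0}"
    and "(\<Sum>j\<in>s. c j *\<^sub>R rcol A j) = 0" "\<And>j. j \<in> s \<Longrightarrow> 0 \<le> c j" "j \<in> s"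
  shows "c j = 0"
proof -
  define x :: "real ^ 'n" where "x = (\<chi> j. if j \<in> s then c j else 0)"
  have "map_matrix real_of_int A *v x = (\<Sum>j\<in>UNIV. x $ j *\<^sub>R rcol A j)"
    by (simp add: map_matrix_def rvec_def rcol_def column_def matrix_vector_mult_def vec_eq_iff mult.commute)
  also have "\<dots> = (\<Sum>j\<in>s. c j *\<^sub>R rcol A j)"
    by (simp add: x_def if_distrib[of "\<lambda>z. z *\<^sub>R _"] sum.inter_restrict[symmetric] cong: if_cong)
  finally have "x \<in> {0}" unfolding kernel[symmetric] using assms by (auto simp: x_def)
  then show ?thesis using \<open>j \<in> s\<close> by (auto simp: x_def vec_eq_iff split: if_splits)
qed

text \<open>A proper face of a convex set has smaller affine dimension, so a full-dimensional face
  is the whole intersection.\<close>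

lemma chamber_is_Inter:
  fixes A :: "int ^ 'n ^ 'd"
  assumes "chamber A \<gamma>"
  obtains b where "\<gamma> = \<Inter>{C \<in> simplicial_cones A. b \<in> C}"
proof -
  obtain b where b: "\<gamma> face_of \<Inter>{C \<in> simplicial_cones A. b \<in> C}" (is "_ face_of ?I")
    and dim: "aff_dim \<gamma> = int CARD('d)"
    using assms by (auto simp: chamber_def chamber_complex_def)
  have "convex ?I"
    by (intro convex_Inter) (auto simp: simplicial_cones_def convex_pos_cone)
  moreover have "\<not> aff_dim \<gamma> < aff_dim ?I" using dim aff_dim_le_DIM[of ?I] by simp
  ultimately have "\<gamma> = ?I" using b face_of_aff_dim_lt by blast
  then show thesis by (rule that)
qed

lemma external_column_mem:
  assumes "external_column A i" "rcol A i \<in> pos_cone A s"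
  shows "i \<in> s"
proof (rule ccontr)
  assume "i \<notin> s"
  then have "pos_cone A s \<subseteq> pos_cone A (UNIV - {i})" by (intro pos_cone_mono) auto
  then show False using assms by (auto simp: external_column_def)
qed

text \<open>Otherwise the full-dimensional chamber would lie in a hyperplane. The gcd condition is
  what makes the normal nonzero.\<close>

lemma chamber_inner_normal_pos:
  fixes \<gamma> :: "(real ^ 'd) set"
  assumes "chamber A \<gamma>" and normal: "min_inner_facet_normal \<gamma> f \<iota>"
  obtains w where "w \<in> \<gamma>" "0 < rvec \<iota> \<bullet> w"
proof (rule ccontr)
  assume "\<not> thesis"
  then have "\<gamma> \<subseteq> {x. rvec \<iota> \<bullet> x = 0}"
    using that normal by (force simp: min_inner_facet_normal_def)
  then have "aff_dim \<gamma> \<le> aff_dim {x. rvec \<iota> \<bullet> x = 0}" by (rule aff_dim_subset)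
  also have "\<dots> = int CARD('d) - 1"
  proof -
    have "\<iota> \<noteq> 0" using normal by (auto simp: min_inner_facet_normal_def image_constant_conv)
    then have "rvec \<iota> \<noteq> 0" by (simp add: rvec_def vec_eq_iff)
    then show ?thesis by simp
  qed
  finally show False using assms(1) by (simp add: chamber_def)
qed

text \<open>Any basis whose cone contains \<open>b\<close> must contain \<open>E\<close>, hence has
  just one free column. A pivot that brings in column \<open>j\<close> keeps \<open>b\<close> in the
  cone and so can only expel that free column.\<close>

lemma external_chamber_geometry:
  fixes A :: "int ^ 'n ^ 'd"
  assumes kernel: "{x :: real ^ 'n. map_matrix real_of_int A *v x = 0 \<and> (\<forall>j. 0 \<le> x $ j)} = {0}"
    and chamber: "chamber A \<gamma>"
    and E: "E \<subseteq> {i. external_column A i}" "Suc (card E) = CARD('d)"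
    and normal: "min_inner_facet_normal \<gamma> (pos_cone A E) \<iota>"
    and j: "j \<notin> E"
  shows "0 < rvec \<iota> \<bullet> rcol A j" (is ?thesis1)
    and "column_basis A (insert j E)" (is ?thesis2)
    and "\<gamma> \<subseteq> pos_cone A (insert j E)" (is ?thesis3)
proof -
  obtain b where \<gamma>: "\<gamma> = \<Inter>{C \<in> simplicial_cones A. b \<in> C}"
    using chamber by (rule chamber_is_Inter)
  have facet: "pos_cone A E \<subseteq> \<gamma>"
    using normal by (auto simp: min_inner_facet_normal_def dest: facet_of_imp_subset)
  have zero: "rvec \<iota> \<bullet> rcol A i = 0" if "i \<in> E" for i
    using normal rcol_mem_pos_cone[OF that, of A] by (auto simp: min_inner_facet_normal_def)
  have cone: "\<gamma> \<subseteq> pos_cone A s" if "column_basis A s" "b \<in> pos_cone A s" for s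
    using that unfolding \<gamma> simplicial_cones_def column_basis_def by blast
  have contains: "E \<subseteq> s" if "column_basis A s" "b \<in> pos_cone A s" for s
    using E(1) external_column_mem rcol_mem_pos_cone[of _ E A] facet cone[OF that] by blast
  have half: "0 \<le> rvec \<iota> \<bullet> x" if "x \<in> \<gamma>" for x
    using normal that by (auto simp: min_inner_facet_normal_def)
  obtain w where w: "w \<in> \<gamma>" "0 < rvec \<iota> \<bullet> w"
    using chamber normal by (rule chamber_inner_normal_pos)
  \<comment> \<open>An intersection over the empty family would be the whole space, so excluding
    that case yields a basis whose cone contains \<open>b\<close>.\<close>
  have "0 < rvec \<iota> \<bullet> rvec \<iota>" using w by auto
  then have "\<gamma> \<noteq> UNIV" using half[of "- rvec \<iota>"]
    by (metis UNIV_I inner_minus_right neg_0_le_iff_le not_less)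
  then obtain s where s: "column_basis A s" "b \<in> pos_cone A s"
    unfolding \<gamma> simplicial_cones_def column_basis_def by blast
  obtain k where k: "s = insert k E" "k \<notin> E"
  proof -
    have "card (s - E) = 1"
      using contains[OF s] s(1) E(2) by (simp add: card_Diff_subset column_basis_def)
    then obtain k where "s - E = {k}" by (auto simp: card_1_singleton_iff)
    then show thesis using that[of k] contains[OF s] by blast
  qed
  have inner: "rvec \<iota> \<bullet> (\<Sum>i\<in>s. c i *\<^sub>R rcol A i) = c k * (rvec \<iota> \<bullet> rcol A k)" for c
    using k zero by (simp add: inner_sum_right inner_add_right)
  have \<iota>k: "0 < rvec \<iota> \<bullet> rcol A k"
  proof -
    obtain c where c: "w = (\<Sum>i\<in>s. c i *\<^sub>R rcol A i)" "\<And>i. i \<in> s \<Longrightarrow> 0 \<le> c i"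
      using cone[OF s] w(1) by (blast elim: pos_coneE)
    have "0 < c k * (rvec \<iota> \<bullet> rcol A k)" using inner[of c, folded c(1)] w by simp
    then show ?thesis using c(2)[of k] k by (simp add: zero_less_mult_iff)
  qed
  have "?thesis1 \<and> ?thesis2 \<and> ?thesis3"
  proof (cases "j = k")
    case True
    then show ?thesis using \<iota>k s k cone[OF s] by simp
  next
    case False
    then have js: "j \<notin> s" using j k by simp
    obtain \<nu> where \<nu>: "rcol A j = (\<Sum>i\<in>s. \<nu> i *\<^sub>R rcol A i)"
      using s(1) by (rule column_basis_coords)
    \<comment> \<open>If no coefficient were positive, moving all terms to one side would give a
      nontrivial nonnegative relation among the columns.\<close>
    have "\<exists>i\<in>s. 0 < \<nu> i"
    proof (rule ccontr)
      assume neg: "\<not> (\<exists>i\<in>s. 0 < \<nu> i)"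
      define c where "c i = (if i = j then 1 else - \<nu> i)" for i
      have "(\<Sum>i\<in>s. c i *\<^sub>R rcol A i) = - rcol A j"
        using js by (simp add: \<nu> flip: sum_negf) (auto simp: c_def intro!: sum.cong)
      then have "(\<Sum>i\<in>insert j s. c i *\<^sub>R rcol A i) = 0" using js by (simp add: c_def)
      then have "c j = 0"
        by (rule nonneg_combination_zero[OF kernel]) (use neg in \<open>auto simp: c_def not_less\<close>)
      then show False by (simp add: c_def)
    qed
    from pos_cone_pivot[OF s js \<nu> this] obtain i where
      i: "i \<in> s" "0 < \<nu> i" "column_basis A (insert j (s - {i}))"
        "b \<in> pos_cone A (insert j (s - {i}))" .
    \<comment> \<open>The new basis again contains \<open>E\<close>, so the expelled index lies
      outside \<open>E\<close>. Then \<open>\<nu> k\<close> is positive, and so is the value of the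
      normal on column \<open>j\<close>.\<close>
    have "i = k" using contains[OF i(3,4)] i(1) k j by auto
    then have "insert j (s - {i}) = insert j E" using k by auto
    then show ?thesis
      using i \<open>i = k\<close> inner[of \<nu>] \<nu> \<iota>k cone[OF i(3,4)] by simp
  qed
  then show ?thesis1 ?thesis2 ?thesis3 by auto
qed

subsection \<open>Vector partitions over an external facet\<close>

lemma chamber_add:
  assumes "chamber A \<gamma>" "x \<in> \<gamma>" "y \<in> \<gamma>"
  shows "x + y \<in> \<gamma>"
proof -
  obtain b where "\<gamma> = \<Inter>{C \<in> simplicial_cones A. b \<in> C}"
    using assms(1) by (rule chamber_is_Inter)
  then show ?thesis using assms by (auto simp: simplicial_cones_def intro!: pos_cone_add)
qed

lemma chamber_scale:
  assumes "chamber A \<gamma>" "x \<in> \<gamma>" "0 \<le> t"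
  shows "t *\<^sub>R x \<in> \<gamma>"
proof -
  obtain b where "\<gamma> = \<Inter>{C \<in> simplicial_cones A. b \<in> C}"
    using assms(1) by (rule chamber_is_Inter)
  then show ?thesis using assms by (auto simp: simplicial_cones_def intro!: pos_cone_scale)
qed

lemma mult_nvec_eq_sum: "A *v nvec x = (\<Sum>j\<in>UNIV. int (x $ j) *s column j A)"
  by (simp add: matrix_mult_sum nvec_def)

lemma col_semigroup_eq: "col_semigroup A UNIV = range (\<lambda>x. A *v nvec x)"
proof (intro equalityI subsetI)
  fix b assume "b \<in> col_semigroup A UNIV"
  then obtain c where "b = (\<Sum>j\<in>UNIV. int (c j) *s column j A)" by (auto simp: col_semigroup_def)
  then have "b = A *v nvec (\<chi> j. c j)" by (simp add: mult_nvec_eq_sum)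
  then show "b \<in> range (\<lambda>x. A *v nvec x)" by blast
qed (auto simp: col_semigroup_def mult_nvec_eq_sum)

lemma col_semigroup_subset_lattice: "col_semigroup A UNIV \<subseteq> col_lattice A"
  by (auto simp: col_semigroup_eq col_lattice_def)

lemma rvec_mult_nvec_split:
  fixes A :: "int ^ 'n ^ 'd"
  shows "rvec (A *v nvec x) =
    (\<Sum>i\<in>E. real (x $ i) *\<^sub>R rcol A i) + (\<Sum>j\<in>-E. real (x $ j) *\<^sub>R rcol A j)"
  unfolding rvec_mult_nvec
  by (subst sum.subset_diff[of E UNIV]) (auto simp: Compl_eq_Diff_UNIV add.commute)

lemma inner_mult_nvec:
  fixes A :: "int ^ 'n ^ 'd"
  assumes "\<And>i. i \<in> E \<Longrightarrow> v \<bullet> rcol A i = 0"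
    and "\<And>j. j \<notin> E \<Longrightarrow> v \<bullet> rcol A j = real (\<beta> j)"
  shows "v \<bullet> rvec (A *v nvec x) = real (\<Sum>j\<in>-E. x $ j * \<beta> j)"
  unfolding rvec_mult_nvec_split[of A x E]
  using assms by (simp add: inner_add_right inner_sum_right)

text \<open>The geometric facts about the inner normal \<open>v\<close> are taken as assumptions.
  The number \<open>\<beta> j\<close> is the height of column \<open>j\<close> above the facet, and
  \<open>m\<close> is a fixed column that completes \<open>E\<close> to a basis.\<close>

locale chamber_over_facet =
  fixes A :: "int ^ 'n ^ 'd" and E :: "'n set" and \<gamma> :: "(real ^ 'd) set"
    and v :: "real ^ 'd" and \<beta> :: "'n \<Rightarrow> nat" and m :: 'n
  assumes zero: "\<And>i. i \<in> E \<Longrightarrow> v \<bullet> rcol A i = 0"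
    and \<beta>: "\<And>j. j \<notin> E \<Longrightarrow> v \<bullet> rcol A j = real (\<beta> j)" "\<And>j. j \<notin> E \<Longrightarrow> 0 < \<beta> j"
    and basis: "\<And>j. j \<notin> E \<Longrightarrow> column_basis A (insert j E)"
    and cone: "\<And>j. j \<notin> E \<Longrightarrow> \<gamma> \<subseteq> pos_cone A (insert j E)"
    and m: "m \<notin> E" and sat: "saturated A E"
    and chamber: "chamber A \<gamma>" and facet: "pos_cone A E \<subseteq> \<gamma>" and inner_pos: "\<exists>w\<in>\<gamma>. 0 < v \<bullet> w"
begin

text \<open>For \<open>b\<close> in the chamber, the multiplicities of the columns outside \<open>E\<close> may be any solution
  of \<open>(\<Sum>j\<in>-E. y j * \<beta> j) = N\<close>: what remains of \<open>b\<close> is a convex combination of the projections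
  of \<open>b\<close> to the facet along these columns, so saturation completes the solution, in exactly one
  way.\<close>

lemma vector_partition_eq_card_solutions:
  assumes b: "b \<in> col_lattice A" "rvec b \<in> \<gamma>" and N: "v \<bullet> rvec b = real N"
  shows "vector_partition A b = card (solutions (-E) \<beta> N)"
  unfolding vector_partition_def
proof (rule bij_betw_same_card)
  \<comment> \<open>The bijection forgets the multiplicities on \<open>E\<close>.\<close>
  let ?r = "\<lambda>(x :: nat ^ 'n) j. if j \<in> E then 0 else x $ j"
  show "bij_betw ?r {x. A *v nvec x = b} (solutions (-E) \<beta> N)"
  proof (rule bij_betw_imageI)
    show "inj_on ?r {x. A *v nvec x = b}"
    proof (rule inj_onI)
      fix x y assume x: "x \<in> {x. A *v nvec x = b}" and y: "y \<in> {x. A *v nvec x = b}"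
        and eq: "?r x = ?r y"
      have off: "x $ j = y $ j" if "j \<notin> E" for j using fun_cong[OF eq, of j] that by simp
      have "rvec (A *v nvec x) = rvec (A *v nvec y)" using x y by simp
      then have "(\<Sum>i\<in>E. real (x $ i) *\<^sub>R rcol A i) = (\<Sum>i\<in>E. real (y $ i) *\<^sub>R rcol A i)"
        using off by (simp add: rvec_mult_nvec_split[of A _ E])
      \<comment> \<open>The equal terms of column \<open>m\<close> are added back so that uniqueness
        of coordinates in a basis applies.\<close>
      then have "(\<Sum>i\<in>insert m E. real (x $ i) *\<^sub>R rcol A i)
          = (\<Sum>i\<in>insert m E. real (y $ i) *\<^sub>R rcol A i)"
        using m off by simp
      then have on: "x $ i = y $ i" if "i \<in> E" for i
        using column_basis_coords_unique[OF basis[OF m], of "\<lambda>i. real (x $ i)" "\<lambda>i. real (y $ i)" i] that by simp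
      show "x = y" using on off by (auto simp: vec_eq_iff)
    qed
    show "?r ` {x. A *v nvec x = b} = solutions (-E) \<beta> N"
    proof (intro equalityI subsetI)
      fix y assume "y \<in> ?r ` {x. A *v nvec x = b}"
      then obtain x where x: "A *v nvec x = b" "y = ?r x" by blast
      have "real (\<Sum>j\<in>-E. x $ j * \<beta> j) = real N"
        using inner_mult_nvec[of E v A \<beta> x] zero \<beta>(1) N x(1) by simp
      then have "(\<Sum>j\<in>-E. x $ j * \<beta> j) = N" by (simp only: of_nat_eq_iff)
      then show "y \<in> solutions (-E) \<beta> N" by (simp add: solutions_def x(2))
    next
      fix y assume y: "y \<in> solutions (-E) \<beta> N"
      have sum: "(\<Sum>j\<in>-E. y j * \<beta> j) = N" and y0: "\<And>j. j \<in> E \<Longrightarrow> y j = 0"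
        using y by (auto simp: solutions_def)
      define c where "c = b - (\<Sum>j\<in>-E. int (y j) *s column j A)"
      \<comment> \<open>Since \<open>v\<close> vanishes on \<open>E\<close>, the coordinate of
        \<open>b\<close> at column \<open>j\<close> must be \<open>N / \<beta> j\<close>; removing
        that term leaves nonnegative coefficients on \<open>E\<close>.\<close>
      have proj: "rvec b - (real N / real (\<beta> j)) *\<^sub>R rcol A j \<in> pos_cone A E" if j: "j \<notin> E" for j
      proof -
        have "rvec b \<in> pos_cone A (insert j E)" using cone[OF j] b(2) by blast
        then obtain l where l: "rvec b = (\<Sum>i\<in>insert j E. l i *\<^sub>R rcol A i)"
          "\<And>i. i \<in> insert j E \<Longrightarrow> 0 \<le> l i" by (rule pos_coneE) blast
        have "v \<bullet> rvec b = l j * real (\<beta> j)"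
          using j zero \<beta>(1)[OF j] by (simp add: l(1) inner_add_right inner_sum_right)
        then have "real N = l j * real (\<beta> j)" using N by simp
        then have "real N / real (\<beta> j) = l j" using \<beta>(2)[OF j] by simp
        then have "rvec b - (real N / real (\<beta> j)) *\<^sub>R rcol A j = (\<Sum>i\<in>E. l i *\<^sub>R rcol A i)"
          using l(1) j by simp
        then show ?thesis using pos_coneI[of E l A] l(2) by simp
      qed
      have rc: "rvec c = rvec b - (\<Sum>j\<in>-E. real (y j) *\<^sub>R rcol A j)"
        using rvec_add[of c "\<Sum>j\<in>-E. int (y j) *s column j A"]
        by (simp add: c_def rvec_sum rvec_scale rcol_def)
      have "rvec c \<in> pos_cone A E"
      \<comment> \<open>The weights \<open>y j * \<beta> j / N\<close> of the convex combination
        need a nonzero \<open>N\<close>. For \<open>N = 0\<close> the solution vanishes and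
        \<open>c\<close> is \<open>b\<close> itself.\<close>
      proof (cases "N = 0")
        case True
        then have "y j = 0" if "j \<notin> E" for j using sum \<beta>(2)[OF that] that by auto
        then show ?thesis using proj[OF m] True by (simp add: rc)
      next
        case False
        have "rvec c = (\<Sum>j\<in>-E. (real (y j * \<beta> j) / real N) *\<^sub>R
            (rvec b - (real N / real (\<beta> j)) *\<^sub>R rcol A j))"
        proof -
          have "(\<Sum>j\<in>-E. real (y j * \<beta> j) / real N) = 1"
            using False sum by (simp flip: sum_divide_distrib of_nat_sum of_nat_mult)
          moreover have "(real (y j * \<beta> j) / real N) *\<^sub>R (real N / real (\<beta> j)) *\<^sub>R rcol A j
              = real (y j) *\<^sub>R rcol A j" if "j \<in> -E" for j
            using False \<beta>(2)[of j] that by simp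
          ultimately show ?thesis
            by (simp only: rc scaleR_diff_right sum_subtractf scaleR_left.sum[symmetric]
                scaleR_one cong: sum.cong)
        qed
        also have "\<dots> \<in> pos_cone A E"
          by (intro pos_cone_sum pos_cone_scale proj) auto
        finally show ?thesis .
      qed
      moreover have "c \<in> col_lattice A"
      proof -
        obtain z where "b = A *v z" using b(1) by (auto simp: col_lattice_def)
        moreover have "(\<Sum>j\<in>-E. int (y j) *s column j A) = A *v nvec (\<chi> j. y j)"
          using y0 by (auto simp: mult_nvec_eq_sum intro!: sum.mono_neutral_left)
        ultimately have "c = A *v (z - nvec (\<chi> j. y j))"
          by (simp add: c_def matrix_vector_mult_diff_distrib)
        then show ?thesis by (auto simp: col_lattice_def)
      qed
      ultimately have "c \<in> col_semigroup A E" using sat by (auto simp: saturated_def)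
      then obtain z where z: "c = (\<Sum>i\<in>E. int (z i) *s column i A)" by (auto simp: col_semigroup_def)
      define x :: "nat ^ 'n" where "x = (\<chi> j. if j \<in> E then z j else y j)"
      have "rvec (A *v nvec x) = rvec c + (\<Sum>j\<in>-E. real (y j) *\<^sub>R rcol A j)"
        by (simp add: rvec_mult_nvec_split[of A _ E] z x_def rvec_sum rvec_scale rcol_def)
      then have "A *v nvec x = b" by (simp add: rc rvec_inject)
      moreover have "y = ?r x" using y0 by (auto simp: x_def)
      ultimately show "y \<in> ?r ` {x. A *v nvec x = b}" by blast
    qed
  qed
qed

text \<open>The point \<open>A *v nvec x\<close> may lie outside the chamber, where nothing is known
  about \<open>P\<close>. Adding many copies of the facet columns moves it inside without changing
  its height, hence without changing the number of solutions; so \<open>P\<close> is constant along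
  this ray.\<close>

lemma card_solutions_eq_polynomial:
  assumes P: "real_polynomial_function P"
    and agree: "\<And>b. b \<in> col_semigroup A UNIV \<Longrightarrow> rvec b \<in> \<gamma> \<Longrightarrow> real (vector_partition A b) = P (rvec b)"
  shows "real (card (solutions (-E) \<beta> (\<Sum>j\<in>-E. x $ j * \<beta> j))) = P (rvec (A *v nvec x))"
proof -
  define N where "N = (\<Sum>j\<in>-E. x $ j * \<beta> j)"
  define u where "u = (\<Sum>i\<in>E. rcol A i)"
  define xs :: "nat \<Rightarrow> nat ^ 'n" where "xs M = (\<chi> j. if j \<in> E then x $ j + M else x $ j)" for M
  have xs: "rvec (A *v nvec (xs M)) = rvec (A *v nvec x) + real M *\<^sub>R u" for M
    by (simp add: rvec_mult_nvec_split[of A _ E] xs_def u_def scaleR_sum_right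
        scaleR_add_left sum.distrib)
  have height: "v \<bullet> rvec (A *v nvec (xs M)) = real N" for M
    using inner_mult_nvec[of E v A \<beta> "xs M"] zero \<beta>(1) by (simp add: N_def xs_def)
  have height0: "v \<bullet> rvec (A *v nvec x) = real N"
    using inner_mult_nvec[of E v A \<beta> x] zero \<beta>(1) by (simp add: N_def)
  obtain w where w: "w \<in> \<gamma>" "0 < v \<bullet> w" using inner_pos by blast
  obtain c where c: "rvec (A *v nvec x) = (\<Sum>i\<in>insert m E. c i *\<^sub>R rcol A i)"
    using basis[OF m] by (rule column_basis_coords)
  obtain d where d: "w = (\<Sum>i\<in>insert m E. d i *\<^sub>R rcol A i)"
    using basis[OF m] by (rule column_basis_coords)
  have inner: "v \<bullet> (\<Sum>i\<in>insert m E. c i *\<^sub>R rcol A i) = c m * real (\<beta> m)" for c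
    using m zero \<beta>(1)[OF m] by (simp add: inner_add_right inner_sum_right)
  have "0 \<le> c m * real (\<beta> m)" using inner[of c, folded c] height0 by simp
  then have cm: "0 \<le> c m" using \<beta>(2)[OF m] by (simp add: zero_le_mult_iff)
  have dm: "0 < d m" using inner[of d, folded d] w(2) \<beta>(2)[OF m] by (simp add: zero_less_mult_iff)
  \<comment> \<open>Scaling \<open>w\<close> by \<open>r\<close> matches the coordinate at column
    \<open>m\<close>. The remaining difference involves only columns of \<open>E\<close>, and
    \<open>M0\<close> makes its coefficients nonnegative.\<close>
  define r where "r = c m / d m"
  have r: "0 \<le> r" "r * d m = c m" using cm dm by (auto simp: r_def)
  obtain M0 :: nat where M0: "(\<Sum>i\<in>E. \<bar>c i - r * d i\<bar>) \<le> real M0" using real_arch_simple by blast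
  have "P (rvec (A *v nvec x) + real M *\<^sub>R u) = real (card (solutions (-E) \<beta> N))" if "M \<ge> M0" for M
  proof -
    have "0 \<le> c i - r * d i + real M" if "i \<in> E" for i
    proof -
      have "\<bar>c i - r * d i\<bar> \<le> (\<Sum>i\<in>E. \<bar>c i - r * d i\<bar>)"
        using that by (intro member_le_sum) auto
      then show ?thesis using M0 \<open>M \<ge> M0\<close> by linarith
    qed
    then have "(\<Sum>i\<in>E. (c i - r * d i + real M) *\<^sub>R rcol A i) \<in> pos_cone A E" by (rule pos_coneI)
    then have "r *\<^sub>R w + (\<Sum>i\<in>E. (c i - r * d i + real M) *\<^sub>R rcol A i) \<in> \<gamma>"
      using facet chamber_add[OF chamber] chamber_scale[OF chamber w(1) r(1)] by blast
    also have "r *\<^sub>R w + (\<Sum>i\<in>E. (c i - r * d i + real M) *\<^sub>R rcol A i)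
        = rvec (A *v nvec (xs M))"
      using m r(2) by (simp add: xs c d u_def scaleR_add_right scaleR_sum_right
          scaleR_add_left scaleR_left_diff_distrib sum.distrib sum_subtractf)
    finally have "rvec (A *v nvec (xs M)) \<in> \<gamma>" .
    moreover have "A *v nvec (xs M) \<in> col_semigroup A UNIV" by (simp add: col_semigroup_eq)
    ultimately show ?thesis
      using agree[of "A *v nvec (xs M)"] col_semigroup_subset_lattice[of A]
        vector_partition_eq_card_solutions[OF _ _ height[of M]]
      by (auto simp: xs)
  qed
  then have "P (rvec (A *v nvec x)) = real (card (solutions (-E) \<beta> N))"
    by (rule real_polynomial_function_eventually_const[OF P])
  then show ?thesis by (simp add: N_def)
qed

text \<open>Divisibility is obtained for every ordered pair of columns outside \<open>E\<close>, so
  antisymmetry gives equality.\<close>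

lemma parts_equal_of_polynomial:
  assumes "polynomial_on {b \<in> col_semigroup A UNIV. rvec b \<in> \<gamma>} (\<lambda>b. real (vector_partition A b))"
    and "j \<notin> E" "k \<notin> E"
  shows "\<beta> j = \<beta> k"
proof -
  obtain P where P: "real_polynomial_function P"
    and agree: "\<And>b. b \<in> col_semigroup A UNIV \<Longrightarrow> rvec b \<in> \<gamma> \<Longrightarrow> real (vector_partition A b) = P (rvec b)"
    using assms(1) unfolding polynomial_on_def by auto
  obtain D where D: "\<And>u w. \<exists>c :: complex poly. (\<forall>i\<ge>D. coeff c i = 0) \<and>
      (\<forall>t. complex_of_real (P (u + t *\<^sub>R w)) = poly c (of_real t))"
    using real_polynomial_function_along_lines[OF P] by metis
  have "\<beta> k dvd \<beta> j" if jk: "j \<notin> E" "k \<notin> E" for j k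
  proof (rule parts_dvd_of_polynomial_in_classes[of "-E" \<beta> j k D])
    fix s assume "solutions (-E) \<beta> s \<noteq> {}"
    then obtain y where y: "y \<in> solutions (-E) \<beta> s" by blast
    \<comment> \<open>Adding \<open>N\<close> copies of column \<open>j\<close> raises the height by
      \<open>N * \<beta> j\<close> while the point moves along a line, on which \<open>P\<close> has
      degree below \<open>D\<close>.\<close>
    define xs :: "nat \<Rightarrow> nat ^ 'n" where "xs N = (\<chi> i. y i + (if i = j then N else 0))" for N
    have "(\<Sum>i\<in>-E. xs N $ i * \<beta> i) = s + N * \<beta> j" for N
    proof -
      have "(\<Sum>i\<in>-E. xs N $ i * \<beta> i) = (\<Sum>i\<in>-E. y i * \<beta> i + (if i = j then N * \<beta> j else 0))"
        by (intro sum.cong) (auto simp: xs_def add_mult_distrib)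
      then show ?thesis using y jk by (simp add: solutions_def sum.distrib)
    qed
    moreover have "rvec (A *v nvec (xs N)) = rvec (A *v nvec (\<chi> i. y i)) + real N *\<^sub>R rcol A j" for N
      by (simp add: rvec_mult_nvec xs_def scaleR_add_left sum.distrib
          if_distrib[of real] if_distrib[of "\<lambda>z. z *\<^sub>R _"] cong: if_cong)
    ultimately have "real (card (solutions (-E) \<beta> (s + N * \<beta> j)))
        = P (rvec (A *v nvec (\<chi> i. y i)) + real N *\<^sub>R rcol A j)" for N
      using card_solutions_eq_polynomial[OF P agree, of "xs N"] by simp
    then show "\<exists>c :: complex poly. (\<forall>i\<ge>D. coeff c i = 0) \<and>
        (\<forall>N. of_nat (card (solutions (-E) \<beta> (s + N * \<beta> j))) = poly c (of_nat N))"
      using D[of "rvec (A *v nvec (\<chi> i. y i))" "rcol A j"] by (metis of_real_of_nat_eq)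
  qed (use jk \<beta>(2) in auto)
  then show ?thesis using assms(2,3) by (simp add: dvd_antisym)
qed

lemma vector_partition_eq_binomial:
  assumes parts: "\<And>j. j \<notin> E \<Longrightarrow> \<beta> j = b\<^sub>0"
    and b: "b \<in> col_semigroup A UNIV" "rvec b \<in> \<gamma>"
  shows "real (vector_partition A b) =
    (v \<bullet> rvec b / real b\<^sub>0 + real (CARD('n) - CARD('d))) gchoose (CARD('n) - CARD('d))"
proof -
  obtain x where x: "b = A *v nvec x" using b(1) by (auto simp: col_semigroup_eq)
  define N where "N = (\<Sum>j\<in>-E. x $ j)"
  have b0: "0 < b\<^sub>0" using parts[OF m] \<beta>(2)[OF m] by simp
  have N: "v \<bullet> rvec b = real (b\<^sub>0 * N)"
    using inner_mult_nvec[of E v A \<beta> x] zero \<beta>(1) parts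
    by (simp add: x N_def sum_distrib_left mult.commute)
  \<comment> \<open>There are \<open>d - 1\<close> columns in \<open>E\<close>, so one fewer than
    the number of remaining columns is exactly \<open>n - d\<close>.\<close>
  have "Suc (card E) = CARD('d)" using basis[OF m] m by (simp add: column_basis_def)
  moreover have "card (-E) = CARD('n) - card E" by (simp add: Compl_eq_Diff_UNIV card_Diff_subset)
  ultimately have "card (-E) - 1 = CARD('n) - CARD('d)" by simp
  then have "vector_partition A b = (N + (CARD('n) - CARD('d))) choose (CARD('n) - CARD('d))"
    using vector_partition_eq_card_solutions[OF subsetD[OF col_semigroup_subset_lattice b(1)] b(2) N]
      card_solutions_const[of "-E" \<beta> b\<^sub>0 N] parts b0 m by auto
  then show ?thesis using b0 by (simp add: N binomial_gbinomial)
qed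

text \<open>With a fixed lower index, a generalized binomial coefficient is a product of affine
  functions of its upper argument divided by a constant.\<close>

lemma vector_partition_polynomial_on:
  assumes "\<And>j. j \<notin> E \<Longrightarrow> \<beta> j = b\<^sub>0"
  shows "polynomial_on {b \<in> col_semigroup A UNIV. rvec b \<in> \<gamma>} (\<lambda>b. real (vector_partition A b))"
proof -
  define P where "P x = ((1 / real b\<^sub>0) * (v \<bullet> x) + real (CARD('n) - CARD('d)))
    gchoose (CARD('n) - CARD('d))" for x
  have "real_polynomial_function P"
    unfolding P_def gbinomial_prod_rev divide_inverse
    by (intro real_polynomial_function.intros(2-4) real_polynomial_function_prod
      real_polynomial_function_diff finite_atLeastLessThan)
      (intro real_polynomial_function.intros(1) bounded_linear_inner_right)
  moreover have "real (vector_partition A b) = P (rvec b)"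
    if "b \<in> col_semigroup A UNIV" "rvec b \<in> \<gamma>" for b
    using vector_partition_eq_binomial[OF assms that] by (simp add: P_def)
  ultimately show ?thesis by (auto simp: polynomial_on_def)
qed

end

section \<open>The determinant formula\<close>

lemma det_of_int: "real_of_int (det B) = det (map_matrix real_of_int B)"
  by (simp add: det_def map_matrix_def)

text \<open>By Cramer's rule the ratio of determinants is the coordinate of \<open>b\<close> at
  column \<open>m\<close>. The functional \<open>v\<close> vanishes on the other basis columns and
  reads off the same coordinate. A sign due to the labelling cancels.\<close>

lemma det_bordered_ratio:
  fixes A :: "int ^ 'n ^ 'd"
  assumes inj: "inj_on \<sigma> (UNIV - {e})" and m: "m \<notin> \<sigma> ` (UNIV - {e})"
    and basis: "column_basis A (insert m (\<sigma> ` (UNIV - {e})))"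
    and zero: "\<And>i. i \<in> \<sigma> ` (UNIV - {e}) \<Longrightarrow> v \<bullet> rcol A i = 0" and v: "v \<bullet> rcol A m \<noteq> 0"
  shows "real_of_int (det (bordered A \<sigma> e b)) / real_of_int (det (bordered A \<sigma> e (column m A)))
    = v \<bullet> rvec b / (v \<bullet> rcol A m)"
proof -
  let ?s = "insert m (\<sigma> ` (UNIV - {e}))"
  \<comment> \<open>This extends the labelling to a bijection from matrix positions onto the basis,
    with \<open>m\<close> in position \<open>e\<close>.\<close>
  define \<tau> where "\<tau> = \<sigma>(e := m)"
  have inj\<tau>: "inj \<tau>" using inj m by (auto simp: \<tau>_def inj_on_def)
  have range: "range \<tau> = ?s" by (auto simp: \<tau>_def)
  define M :: "real ^ 'd ^ 'd" where "M = map_matrix real_of_int (bordered A \<sigma> e (column m A))"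
  have M: "M *v x = (\<Sum>k\<in>UNIV. x $ k *\<^sub>R rcol A (\<tau> k))" for x
    by (auto simp: M_def map_matrix_def bordered_def matrix_vector_mult_def vec_eq_iff rcol_def
        rvec_def column_def \<tau>_def intro!: sum.cong)
  have reindex: "(\<Sum>j\<in>?s. c j *\<^sub>R rcol A j) = (\<Sum>k\<in>UNIV. c (\<tau> k) *\<^sub>R rcol A (\<tau> k))" for c
    using sum.reindex[OF inj\<tau>, of "\<lambda>j. c j *\<^sub>R rcol A j"] by (simp add: range)
  have "inj ((*v) M)"
  proof (rule injI)
    fix x y assume "M *v x = M *v y"
    then have "(\<Sum>j\<in>?s. x $ inv \<tau> j *\<^sub>R rcol A j) = (\<Sum>j\<in>?s. y $ inv \<tau> j *\<^sub>R rcol A j)"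
      by (simp add: M reindex inv_f_f[OF inj\<tau>] del: sum.insert)
    then have "x $ inv \<tau> j = y $ inv \<tau> j" if "j \<in> ?s" for j
      using column_basis_coords_unique[OF basis _ that, of "\<lambda>j. x $ inv \<tau> j" "\<lambda>j. y $ inv \<tau> j"]
      by blast
    then have "x $ k = y $ k" for k
      using inv_f_f[OF inj\<tau>, of k] range rangeI[of \<tau> k] by metis
    then show "x = y" by (simp add: vec_eq_iff)
  qed
  then have nz: "det M \<noteq> 0" using det_nz_iff_inj[OF matrix_vector_mul_linear[of M]] by simp
  obtain c where c: "rvec b = (\<Sum>j\<in>?s. c j *\<^sub>R rcol A j)" using basis by (rule column_basis_coords)
  have cm: "v \<bullet> rvec b = c m * (v \<bullet> rcol A m)"
    using zero m by (simp add: c inner_add_right inner_sum_right)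
  define x :: "real ^ 'd" where "x = (\<chi> k. c (\<tau> k))"
  have Mx: "M *v x = rvec b" by (simp add: M c reindex x_def del: sum.insert)
  have "det (\<chi> i k. if k = e then rvec b $ i else M $ i $ k) = x $ e * det M"
    using cramer_lemma[of e M x] by (simp only: Mx)
  moreover have "(\<chi> i k. if k = e then rvec b $ i else M $ i $ k)
      = map_matrix real_of_int (bordered A \<sigma> e b)"
    by (simp add: M_def map_matrix_def bordered_def rvec_def vec_eq_iff)
  moreover have "x $ e = c m" by (simp add: x_def \<tau>_def)
  ultimately have "real_of_int (det (bordered A \<sigma> e b)) = c m * det M" by (simp add: det_of_int)
  moreover have "real_of_int (det (bordered A \<sigma> e (column m A))) = det M"
    by (simp add: det_of_int M_def)
  ultimately show ?thesis using nz v cm by simp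
qed

theorem theorem5p4:
  fixes A :: "int ^ 'n ^ 'd"
    and \<gamma> f :: "(real ^ 'd) set"
    and \<iota> :: "int ^ 'd"
    and p :: "int ^ 'd \<Rightarrow> real"
    and \<sigma> :: "'d \<Rightarrow> 'n" and e :: 'd and m :: 'n
  assumes rank: "rank (map_matrix real_of_int A) = CARD('d)"
    and kernel: "{x :: real ^ 'n. map_matrix real_of_int A *v x = 0 \<and> (\<forall>j. 0 \<le> x $ j)} = {0}"
    and chamber: "external_chamber A \<gamma>"
    and facet: "f = external_facet A \<gamma>"
    and normal: "min_inner_facet_normal \<gamma> f \<iota>"
    and labelling: "inj_on \<sigma> (UNIV - {e})" "external_columns_of A \<gamma> = \<sigma> ` (UNIV - {e})"
    and other_column: "m \<notin> \<sigma> ` (UNIV - {e})"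
    and saturated: "saturated A (\<sigma> ` (UNIV - {e}))"
    and p: "chamber_quasi_polynomial A \<gamma> p"
  shows "(polynomial_on {b \<in> col_semigroup A UNIV. rvec b \<in> \<gamma>} p \<longleftrightarrow>
           (\<exists>\<beta>::int. \<beta> > 0 \<and>
             (\<forall>j. rvec \<iota> \<bullet> rcol A j = (if rcol A j \<in> f then 0 else real_of_int \<beta>)))) \<and>
         (polynomial_on (col_semigroup A UNIV) p \<longrightarrow>
           (\<exists>\<beta>::int. \<beta> > 0 \<and>
             (\<forall>j. rvec \<iota> \<bullet> rcol A j = (if rcol A j \<in> f then 0 else real_of_int \<beta>)) \<and>
             (\<forall>b \<in> col_semigroup A UNIV. rvec b \<in> \<gamma> \<longrightarrow>
               p b = (rvec \<iota> \<bullet> rvec b / real_of_int \<beta> + real (CARD('n) - CARD('d)))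
                       gchoose (CARD('n) - CARD('d)) \<and>
               p b = (real_of_int (det (bordered A \<sigma> e b))
                        / real_of_int (det (bordered A \<sigma> e (column m A)))
                        + real (CARD('n) - CARD('d)))
                       gchoose (CARD('n) - CARD('d)))))"
proof -
  let ?E = "\<sigma> ` (UNIV - {e})" and ?v = "rvec \<iota>"
  \<comment> \<open>Passing to natural numbers loses nothing where \<open>\<beta>\<close> is used:
    outside \<open>?E\<close> these integers are positive.\<close>
  define \<beta> where "\<beta> j = nat (\<Sum>i\<in>UNIV. \<iota> $ i * column j A $ i)" for j
  have \<gamma>: "chamber A \<gamma>" using chamber by (simp add: external_chamber_def)
  have f: "f = pos_cone A ?E" using facet labelling(2) by (simp add: external_facet_def)
  have E: "?E \<subseteq> {i. external_column A i}" "Suc (card ?E) = CARD('d)"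
    using labelling by (auto simp: external_columns_of_def card_image)
  note geometry = external_chamber_geometry[OF kernel \<gamma> E normal[unfolded f]]
  have on_f: "?v \<bullet> x = 0" if "x \<in> f" for x
    using normal that by (auto simp: min_inner_facet_normal_def)
  have zero: "?v \<bullet> rcol A i = 0" if "i \<in> ?E" for i
    using on_f rcol_mem_pos_cone[OF that] f by blast
  have \<beta>: "?v \<bullet> rcol A j = real (\<beta> j)" "0 < \<beta> j" if "j \<notin> ?E" for j
    using geometry(1)[OF that] by (auto simp: \<beta>_def rcol_def rvec_inner simp del: of_int_sum)
  \<comment> \<open>The normal vanishes on \<open>f\<close> and is positive on the columns outside
    \<open>?E\<close>, so membership in the facet becomes a condition on indices.\<close>
  have mem_f: "rcol A j \<in> f \<longleftrightarrow> j \<in> ?E" for j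
    using geometry(1)[of j] on_f[of "rcol A j"] rcol_mem_pos_cone[of j ?E A] f
    by (metis less_irrefl)
  interpret chamber_over_facet A ?E \<gamma> ?v \<beta> m
  proof
    show "pos_cone A ?E \<subseteq> \<gamma>"
      using normal f by (auto simp: min_inner_facet_normal_def dest: facet_of_imp_subset)
    show "\<exists>w\<in>\<gamma>. 0 < ?v \<bullet> w" using chamber_inner_normal_pos[OF \<gamma> normal] by blast
  qed (use zero \<beta> geometry other_column saturated \<gamma> in auto)
  have count: "p b = real (vector_partition A b)" if "rvec b \<in> \<gamma>" for b
    using p that by (simp add: chamber_quasi_polynomial_def)
  have equal_parts: "(\<forall>j. ?v \<bullet> rcol A j = (if rcol A j \<in> f then 0 else real_of_int b)) \<longleftrightarrow>
      (\<forall>j. j \<notin> ?E \<longrightarrow> int (\<beta> j) = b)" for b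
    using zero \<beta>(1) by (auto simp: mem_f)
  have poly_iff: "polynomial_on {b \<in> col_semigroup A UNIV. rvec b \<in> \<gamma>} p \<longleftrightarrow>
      polynomial_on {b \<in> col_semigroup A UNIV. rvec b \<in> \<gamma>} (\<lambda>b. real (vector_partition A b))"
    using count by (auto simp: polynomial_on_def)
  have poly_imp: "0 < int (\<beta> m) \<and> (\<forall>j. j \<notin> ?E \<longrightarrow> int (\<beta> j) = int (\<beta> m))"
    if "polynomial_on {b \<in> col_semigroup A UNIV. rvec b \<in> \<gamma>} p"
    using parts_equal_of_polynomial[OF that[unfolded poly_iff] _ m] \<beta>(2)[OF m] by auto
  have "polynomial_on {b \<in> col_semigroup A UNIV. rvec b \<in> \<gamma>} p"
    if "0 < b" "\<forall>j. j \<notin> ?E \<longrightarrow> int (\<beta> j) = b" for b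
    unfolding poly_iff using that by (intro vector_partition_polynomial_on[of "nat b"]) auto
  then have "polynomial_on {b \<in> col_semigroup A UNIV. rvec b \<in> \<gamma>} p \<longleftrightarrow>
      (\<exists>b>0. \<forall>j. j \<notin> ?E \<longrightarrow> int (\<beta> j) = b)"
    using poly_imp by blast
  moreover have "\<exists>b>0. (\<forall>j. j \<notin> ?E \<longrightarrow> int (\<beta> j) = b) \<and>
      (\<forall>x \<in> col_semigroup A UNIV. rvec x \<in> \<gamma> \<longrightarrow>
        p x = (?v \<bullet> rvec x / real_of_int b + real (CARD('n) - CARD('d)))
                gchoose (CARD('n) - CARD('d)) \<and>
        p x = (real_of_int (det (bordered A \<sigma> e x))
                 / real_of_int (det (bordered A \<sigma> e (column m A)))
                 + real (CARD('n) - CARD('d)))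
                gchoose (CARD('n) - CARD('d)))"
    if "polynomial_on (col_semigroup A UNIV) p"
  proof -
    \<comment> \<open>Restricting the polynomial from the semigroup to its part in the chamber
      already yields the common height \<open>\<beta> m\<close>.\<close>
    have "polynomial_on {b \<in> col_semigroup A UNIV. rvec b \<in> \<gamma>} p"
      using that by (auto simp: polynomial_on_def)
    note eq = poly_imp[OF this]
    have parts: "\<beta> j = \<beta> m" if "j \<notin> ?E" for j using eq that by auto
    have "det (bordered A \<sigma> e x) / det (bordered A \<sigma> e (column m A)) = ?v \<bullet> rvec x / \<beta> m" for x
      using det_bordered_ratio[OF labelling(1) other_column basis[OF m] zero, where b = x]
        \<beta>[OF m] by simp
    then show ?thesis
      using eq count vector_partition_eq_binomial[OF parts] by (intro exI[of _ "int (\<beta> m)"]) simp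
  qed
  ultimately show ?thesis unfolding equal_parts by blast
qed

end
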